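(* Let $A$ be a C$^*$-algebra and let $\Delta : A\to A$ be a weak-2-local $^*$-derivation, that is, a map (not assumed linear nor continuous) such that for every $a,b\in A$ and every $\phi\in A^{*}$ there exists a $^*$-derivation $D_{a,b,\phi}: A\to A$ (depending on $a$, $b$ and $\phi$) satisfying $\phi(\Delta(a)) = \phi(D_{a,b,\phi}(a))$ and $\phi(\Delta(b)) = \phi(D_{a,b,\phi}(b))$. Then $\Delta$ is a linear $^*$-derivation.
   Context: A derivation on $A$ is a linear map $D:A\to A$ with $D(xy)=D(x)y+xD(y)$ for all $x,y\in A$. A $^*$-derivation is a derivation $D$ which is also symmetric, i.e. $D(x^* )=D(x)^*$ for all $x\in A$. $A^*$ denotes the Banach dual of $A$. *)

theory Defs
  imports "HOL-Analysis.Analysis"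
begin

text \<open>
  C*-algebras as a type class. The underlying ring is not assumed to have a unit, and the zero
  algebra is allowed; completeness and submultiplicativity of the norm are inherited from the
  parent classes. Since those only provide a real vector space, complex scalar multiplication
  is added here and \<open>scaleR_scaleC\<close> makes the inherited real one its restriction.
\<close>

class cstar_algebra = banach + real_normed_algebra +
  fixes scaleC :: "complex \<Rightarrow> 'a \<Rightarrow> 'a" (infixr \<open>*\<^sub>C\<close> 75)
    and star :: "'a \<Rightarrow> 'a"
  assumes scaleC_add_right: "c *\<^sub>C (x + y) = c *\<^sub>C x + c *\<^sub>C y"
    and scaleC_add_left: "(c + d) *\<^sub>C x = c *\<^sub>C x + d *\<^sub>C x"
    and scaleC_scaleC: "c *\<^sub>C (d *\<^sub>C x) = (c * d) *\<^sub>C x"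
    and scaleR_scaleC: "r *\<^sub>R x = complex_of_real r *\<^sub>C x"
    and mult_scaleC_left: "(c *\<^sub>C x) * y = c *\<^sub>C (x * y)"
    and mult_scaleC_right: "x * (c *\<^sub>C y) = c *\<^sub>C (x * y)"
    and norm_scaleC: "norm (c *\<^sub>C x) = cmod c * norm x"
    and star_add: "star (x + y) = star x + star y"
    and star_scaleC: "star (c *\<^sub>C x) = cnj c *\<^sub>C star x"
    and star_mult: "star (x * y) = star y * star x"
    and star_star: "star (star x) = x"
    and cstar_identity: "norm (star x * x) = (norm x)\<^sup>2"

lemma vector_space_scaleC:
  "vector_space (scaleC :: complex \<Rightarrow> 'a::cstar_algebra \<Rightarrow> 'a)"
proof
  show "1 *\<^sub>C x = x" for x :: 'a
    using scaleR_scaleC[of 1 x] by simp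
qed (simp_all add: scaleC_add_right scaleC_add_left scaleC_scaleC)

text \<open>Linearity is over the complex numbers, with \<open>Vector_Spaces.linear\<close>; the unqualified
  \<open>linear\<close> and \<open>bounded_linear\<close> of the library are real.\<close>

definition dual_space :: "('a::cstar_algebra \<Rightarrow> complex) set" where
  "dual_space = {\<phi>. Vector_Spaces.linear scaleC (*) \<phi> \<and> bounded_linear \<phi>}"

definition derivation :: "('a::cstar_algebra \<Rightarrow> 'a) \<Rightarrow> bool" where
  "derivation D \<longleftrightarrow>
     Vector_Spaces.linear scaleC scaleC D \<and> (\<forall>x y. D (x * y) = D x * y + x * D y)"

definition star_derivation :: "('a::cstar_algebra \<Rightarrow> 'a) \<Rightarrow> bool" where
  "star_derivation D \<longleftrightarrow> derivation D \<and> (\<forall>x. D (star x) = star (D x))"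

definition weak_2_local_star_derivation :: "('a::cstar_algebra \<Rightarrow> 'a) \<Rightarrow> bool" where
  "weak_2_local_star_derivation \<Delta> \<longleftrightarrow>
     (\<forall>a b. \<forall>\<phi>\<in>dual_space. \<exists>D. star_derivation D \<and> \<phi> (\<Delta> a) = \<phi> (D a) \<and> \<phi> (\<Delta> b) = \<phi> (D b))"

end

theory Submission
  imports Defs
begin

text \<open>
  A hermitian functional is real on \<open>D a\<close> for every *-derivation \<open>D\<close> and self-adjoint \<open>a\<close>, so
  testing \<open>\<Delta>\<close> at one point \<open>a + \<i>b\<close> tests it at \<open>a\<close> and \<open>b\<close> simultaneously. Pairing
  \<open>a + \<i>b\<close> with \<open>a + b\<close> gives additivity, and \<open>a + \<i>a\<^sup>2\<close> gives
  \<open>\<Delta> (a\<^sup>2) = \<Delta> a a + a \<Delta> a\<close>; no continuity is needed. Hermitian functionals separate points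
  by Hahn--Banach. Finally, a Jordan derivation of a 2-torsion-free semiprime ring is a
  derivation (Bresar's argument), and C*-algebras are semiprime.
\<close>

subsection \<open>Jordan derivations of semiprime rings\<close>

locale semiprime_jordan =
  fixes T :: "'a::ring \<Rightarrow> 'a"
  assumes two_torsion_free: "\<And>x::'a. x + x = 0 \<Longrightarrow> x = 0"
    and semiprime: "\<And>x::'a. (\<And>y. x * y * x = 0) \<Longrightarrow> x = 0"
    and add: "\<And>x y. T (x + y) = T x + T y"
    and square: "\<And>x. T (x * x) = T x * x + x * T x"
begin

lemma halve: "x = y" if "x + x = y + (y::'a)"
proof -
  have "(x - y) + (x - y) = 0"
    using that by (simp add: algebra_simps)
  then show ?thesis
    using two_torsion_free[of "x - y"] by simp
qed

sublocale additive T
  by unfold_locales (rule add)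

lemma jordan_product: "T (x * y + y * x) = T x * y + x * T y + T y * x + y * T x"
  using square[of "x + y"] by (simp add: add square algebra_simps)

text \<open>The Jordan product of \<open>x\<close> with \<open>x * y + y * x\<close> exceeds that of
  \<open>x * x\<close> with \<open>y\<close> by exactly twice \<open>x * y * x\<close>. Both are
  governed by \<open>jordan_product\<close>, and the factor two cancels.\<close>

lemma triple: "T (x * y * x) = T x * y * x + x * T y * x + x * y * T x"
proof (rule halve)
  have "T (x * y * x) + T (x * y * x) = T (x * (x * y + y * x) + (x * y + y * x) * x) - T ((x * x) * y + y * (x * x))"
    by (simp add: add algebra_simps)
  also have "\<dots> = (T x * y * x + x * T y * x + x * y * T x) + (T x * y * x + x * T y * x + x * y * T x)"
    unfolding jordan_product[of x "x * y + y * x"] jordan_product[of "x * x" y]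
    by (simp add: jordan_product square algebra_simps)
  finally show "T (x * y * x) + T (x * y * x) = \<dots>" .
qed

text \<open>Polarisation of \<open>triple\<close> in the outer variable.\<close>

lemma triple_linearized:
  "T (x * y * z + z * y * x) =
    T x * y * z + x * T y * z + x * y * T z + T z * y * x + z * T y * x + z * y * T x"
  using triple[of "x + z" y] triple[of x y] triple[of z y] by (simp add: add algebra_simps)

section \<open>Defect of the Leibniz rule and its annihilation of commutators\<close>

definition defect :: "'a \<Rightarrow> 'a \<Rightarrow> 'a" where
  "defect x y = T (x * y) - T x * y - x * T y"

lemma defect_add: "defect (x + x') y = defect x y + defect x' y"
  "defect x (y + y') = defect x y + defect x y'"
  by (simp_all add: defect_def add algebra_simps)

text \<open>The Jordan product rule says exactly that the symmetric part of \<open>defect\<close>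
  vanishes.\<close>

lemma defect_commute: "defect y x = - defect x y"
  using jordan_product[of x y] by (simp add: defect_def add algebra_simps)

text \<open>Obtained by expanding \<open>T (abcba + bacab)\<close> in two ways.\<close>

lemma defect_commutator:
  "defect a b * c * (a * b - b * a) + (a * b - b * a) * c * defect a b = 0"
proof -
  have "T ((a * b) * c * (b * a) + (b * a) * c * (a * b)) = T (a * (b * c * b) * a) + T (b * (a * c * a) * b)"
    by (simp add: add mult.assoc)
  then have "defect a b * c * (b * a) + (a * b) * c * defect b a
      + defect b a * c * (a * b) + (b * a) * c * defect a b = 0"
    unfolding triple_linearized triple defect_def by (simp add: algebra_simps)
  then show ?thesis
    unfolding defect_commute[of b a] by (simp add: algebra_simps)
qed

text \<open>Exchanging \<open>x\<close> and \<open>y\<close> around a middle factor costs a sign.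
  One exchange, at \<open>z\<close>, turns the sandwich of \<open>x * c * y\<close> into minus
  \<open>(x * c * x) * z * (y * c * y)\<close>; two exchanges, at \<open>c\<close> and at
  \<open>c * x * z\<close>, turn it into plus the same element.\<close>

lemma semiprime_swap:
  assumes "\<And>c. x * c * y + y * c * (x::'a) = 0"
  shows "x * c * y = 0"
proof (rule semiprime)
  fix z
  have swap: "x * c * y = - (y * c * x)" for c
    using assms by (simp add: eq_neg_iff_add_eq_0)
  have "(x * c * y) * z * (x * c * y) = x * c * (y * z * x) * c * y"
    by (simp add: mult.assoc)
  also have "\<dots> = x * c * - (x * z * y) * c * y"
    using swap[of z] by simp
  also have "\<dots> = - ((x * c * x) * z * (y * c * y))"
    by (simp add: mult.assoc)
  finally have 1: "(x * c * y) * z * (x * c * y) = - ((x * c * x) * z * (y * c * y))" .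
  have "(x * c * y) * z * (x * c * y) = - (y * c * x) * z * (x * c * y)"
    using arg_cong[OF swap[of c], of "\<lambda>u. u * z * (x * c * y)"] .
  also have "\<dots> = - (y * (c * x * z) * x) * c * y"
    by (simp add: mult.assoc)
  also have "\<dots> = x * (c * x * z) * y * c * y"
    using arg_cong[OF swap[of "c * x * z"], of "\<lambda>u. u * c * y"] by simp
  finally have "(x * c * y) * z * (x * c * y) = (x * c * x) * z * (y * c * y)"
    by (simp add: mult.assoc)
  with 1 show "(x * c * y) * z * (x * c * y) = 0"
    using two_torsion_free by (metis add.left_inverse)
qed

lemma defect_mult_commutator_same: "defect a b * c * (a * b - b * a) = 0"
  by (rule semiprime_swap, rule defect_commutator)

text \<open>Linearising the previous lemma in \<open>b\<close> trades \<open>b\<close> and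
  \<open>v\<close> between defect and commutator at the cost of a sign. Doing so in the right half
  of the sandwich leaves \<open>defect a b\<close> on the far left and the commutator of
  \<open>a\<close> and \<open>b\<close> on the far right, a product known to vanish.\<close>

lemma defect_mult_commutator_left: "defect a b * c * (a * v - v * a) = 0"
proof (rule semiprime)
  fix z
  have "defect a b * c * (a * v - v * a) + defect a v * c * (a * b - b * a) = 0"
    using defect_mult_commutator_same[of a "b + v" c] defect_mult_commutator_same[of a b c]
      defect_mult_commutator_same[of a v c]
    by (simp add: defect_add algebra_simps)
  then have "defect a b * c * (a * v - v * a) = - (defect a v * c * (a * b - b * a))"
    by (simp add: eq_neg_iff_add_eq_0)
  then have "defect a b * c * (a * v - v * a) * z * (defect a b * c * (a * v - v * a)) =
      - (defect a b * (c * (a * v - v * a) * z * defect a v * c) * (a * b - b * a))"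
    by (metis mult.assoc mult_minus_right)
  then show "defect a b * c * (a * v - v * a) * z * (defect a b * c * (a * v - v * a)) = 0"
    using defect_mult_commutator_same by simp
qed

text \<open>The same trade in the first variable frees the commutator from the arguments of the
  defect.\<close>

lemma defect_mult_commutator: "defect a b * c * (u * v - v * u) = 0"
proof (rule semiprime)
  fix z
  have "defect a b * c * (u * v - v * u) + defect u b * c * (a * v - v * a) = 0"
    using defect_mult_commutator_left[of "a + u" b c v] defect_mult_commutator_left[of a b c v]
      defect_mult_commutator_left[of u b c v]
    by (simp add: defect_add algebra_simps)
  then have "defect a b * c * (u * v - v * u) = - (defect u b * c * (a * v - v * a))"
    by (simp add: eq_neg_iff_add_eq_0)
  then have "defect a b * c * (u * v - v * u) * z * (defect a b * c * (u * v - v * u)) =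
      - (defect a b * (c * (u * v - v * u) * z * defect u b * c) * (a * v - v * a))"
    by (metis mult.assoc mult_minus_right)
  then show "defect a b * c * (u * v - v * u) * z * (defect a b * c * (u * v - v * u)) = 0"
    using defect_mult_commutator_left by simp
qed

text \<open>In the sandwich of this product a defect stands to the left of a commutator, so the
  one-sided result already kills it.\<close>

lemma commutator_mult_defect: "(u * v - v * u) * c * defect a b = 0"
proof (rule semiprime)
  fix z
  have "(u * v - v * u) * c * defect a b * z * ((u * v - v * u) * c * defect a b)
    = (u * v - v * u) * c * (defect a b * z * (u * v - v * u)) * c * defect a b"
    by (simp add: mult.assoc)
  then show "(u * v - v * u) * c * defect a b * z * ((u * v - v * u) * c * defect a b) = 0"
    by (simp add: defect_mult_commutator)
qed

text \<open>The commutator \<open>w\<close> is annihilated by \<open>p\<close> on both sides, while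
  \<open>T w\<close> is \<open>2 p\<close> plus commutators. Applying \<open>T\<close> to
  \<open>w * y * p + p * y * w = 0\<close> therefore produces terms in \<open>p\<close> alone, once
  the terms containing \<open>w\<close> are removed.\<close>

lemma defect_eq_0: "defect a b = 0"
proof -
  define p where "p = defect a b"
  define w where "w = a * b - b * a"
  have pw: "p * y * w = 0" and wp: "w * y * p = 0" for y
    by (simp_all add: p_def w_def defect_mult_commutator commutator_mult_defect)
  have Tw: "T w = p + p + (T a * b - b * T a) + (a * T b - T b * a)"
    using defect_commute[of b a] unfolding p_def w_def defect_def
    by (simp add: diff algebra_simps)
  have pTw: "p * y * T w = p * y * p + p * y * p" and Twp: "T w * y * p = p * y * p + p * y * p" for y
    using defect_mult_commutator[of a b y] commutator_mult_defect[of _ _ y a b]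
    unfolding Tw p_def[symmetric] by (simp_all only: distrib_left distrib_right add_0_right)
  have "(T w * y * p + p * y * T w) + (w * y * T p + T p * y * w) = 0" for y
    using triple_linearized[of w y p] pw[of y] wp[of y] pw[of "T y"] wp[of "T y"]
    by (simp add: zero algebra_simps)
  \<comment> \<open>Multiplying by \<open>p * z\<close> on the left and \<open>t * p\<close> on the
    right places every remaining \<open>w\<close> opposite a \<open>p\<close>, so only the terms
    with \<open>T w\<close> survive.\<close>
  then have "p * z * ((T w * y * p + p * y * T w) + (w * y * T p + T p * y * w)) * t * p = 0" for z y t
    by simp
  moreover have "p * z * ((T w * y * p + p * y * T w) + (w * y * T p + T p * y * w)) * t * p
    = p * z * (T w * y * p + p * y * T w) * t * p + (p * z * w) * y * T p * t * p + p * z * T p * y * (w * t * p)"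
    for z y t
    by (simp add: algebra_simps)
  ultimately have "p * z * (T w * y * p + p * y * T w) * t * p = 0" for z y t
    by (simp add: pw wp)
  then have "(p * z * (p * y * p) * t * p + p * z * (p * y * p) * t * p)
      + (p * z * (p * y * p) * t * p + p * z * (p * y * p) * t * p) = 0" for z y t
    unfolding pTw Twp by (simp only: distrib_left distrib_right)
  then have "p * z * (p * y * p) * t * p = 0" for z y t
    by (blast intro: two_torsion_free)
  \<comment> \<open>Choosing \<open>z = t\<close> gives the sandwich of \<open>p * t * p\<close>.
    Semiprimeness is then used twice, for \<open>p * t * p\<close> and for \<open>p\<close>.\<close>
  then have "(p * t * p) * y * (p * t * p) = 0" for y t
    by (simp add: mult.assoc)
  then show ?thesis
    using semiprime unfolding p_def by blast
qed

theorem jordan_derivation_is_derivation: "T (x * y) = T x * y + x * T y"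
  using defect_eq_0[of x y] by (simp add: defect_def algebra_simps)

end

subsection \<open>Norming functionals\<close>

text \<open>Homogeneity is stated as an inequality, which is easier to verify for infima; rescaling
  by \<open>1 / t\<close> turns it into an equality.\<close>

definition sublinear :: "('a::real_vector \<Rightarrow> real) \<Rightarrow> bool" where
  "sublinear p \<longleftrightarrow> (\<forall>x y. p (x + y) \<le> p x + p y) \<and> (\<forall>t>0. \<forall>x. p (t *\<^sub>R x) \<le> t * p x)"

lemma sublinear_add: "sublinear p \<Longrightarrow> p (x + y) \<le> p x + p y"
  by (simp add: sublinear_def)

lemma sublinear_scaleR:
  assumes "sublinear p" "0 < t"
  shows "p (t *\<^sub>R x) = t * p x"
proof (rule antisym)
  show "p (t *\<^sub>R x) \<le> t * p x"
    using assms by (simp add: sublinear_def)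
  have "p ((1 / t) *\<^sub>R t *\<^sub>R x) \<le> (1 / t) * p (t *\<^sub>R x)"
    using assms unfolding sublinear_def by (metis zero_less_divide_1_iff)
  then show "t * p x \<le> p (t *\<^sub>R x)"
    using assms by (simp add: field_simps)
qed

lemma sublinear_0: "sublinear p \<Longrightarrow> p 0 = 0"
  using sublinear_scaleR[of p 2 0] by simp

lemma sublinear_minus: "sublinear p \<Longrightarrow> - p (- x) \<le> p x"
  using sublinear_add[of p x "- x"] sublinear_0[of p] by simp

lemma sublinear_norm: "sublinear norm"
  by (simp add: sublinear_def norm_triangle_ineq)

text \<open>The bound at \<open>x + y\<close> makes a minimal sublinear \<open>p\<close> superadditive; the one at \<open>x = - y\<close>
  makes every linear functional below \<open>q\<close> at least \<open>p y\<close> at \<open>y\<close>.\<close>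

lemma sublinear_tilt:
  assumes p: "sublinear p"
  obtains q where "sublinear q" "\<And>x. q x \<le> p x" "\<And>x. q x \<le> p (x + y) - p y"
proof
  \<comment> \<open>The values \<open>t = 0\<close> and \<open>t = 1\<close> give the two required
    bounds.\<close>
  define q where "q x = (INF t\<in>{0..}. p (x + t *\<^sub>R y) - t * p y)" for x
  have scale: "p (t *\<^sub>R y) = t * p y" if "0 \<le> t" for t
    using that sublinear_scaleR[OF p] sublinear_0[OF p] by (cases "t = 0") auto
  \<comment> \<open>A lower bound independent of \<open>t\<close>, without which the real infimum
    would carry no information.\<close>
  have "- p (- x) \<le> p (x + t *\<^sub>R y) - t * p y" if "0 \<le> t" for x t
    using sublinear_add[OF p, of "x + t *\<^sub>R y" "- x"] scale[OF that] by simp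
  then have bdd: "bdd_below ((\<lambda>t. p (x + t *\<^sub>R y) - t * p y) ` {0..})" for x
    by (intro bdd_belowI2) auto
  have lower: "q x \<le> p (x + t *\<^sub>R y) - t * p y" if "0 \<le> t" for x t
    unfolding q_def by (rule cINF_lower[OF bdd]) (use that in auto)
  show "q x \<le> p x" for x
    using lower[of 0 x] by simp
  show "q x \<le> p (x + y) - p y" for x
    using lower[of 1 x] by simp
  show "sublinear q"
    unfolding sublinear_def
  proof safe
    fix x x'
    \<comment> \<open>Parameters \<open>t\<close> for \<open>x\<close> and \<open>s\<close> for
      \<open>x'\<close> combine to the parameter \<open>t + s\<close> for the sum.\<close>
    have "q (x + x') - (p (x' + s *\<^sub>R y) - s * p y) \<le> q x" if "0 \<le> s" for s
      unfolding q_def[of x]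
    proof (rule cINF_greatest, simp)
      fix t :: real assume "t \<in> {0..}"
      then show "q (x + x') - (p (x' + s *\<^sub>R y) - s * p y) \<le> p (x + t *\<^sub>R y) - t * p y"
        using lower[of "t + s" "x + x'"] \<open>0 \<le> s\<close> sublinear_add[OF p, of "x + t *\<^sub>R y" "x' + s *\<^sub>R y"]
        by (simp add: algebra_simps)
    qed
    then have "q (x + x') - q x \<le> q x'"
      unfolding q_def[of x'] by (intro cINF_greatest) (auto simp: algebra_simps)
    then show "q (x + x') \<le> q x + q x'"
      by simp
  next
    fix t :: real and x assume "0 < t"
    have "q (t *\<^sub>R x) / t \<le> q x"
      unfolding q_def[of x]
    proof (rule cINF_greatest, simp)
      fix s :: real assume "s \<in> {0..}"
      then have "q (t *\<^sub>R x) \<le> t * p (x + s *\<^sub>R y) - t * s * p y"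
        using lower[of "t * s" "t *\<^sub>R x"] \<open>0 < t\<close> sublinear_scaleR[OF p \<open>0 < t\<close>, of "x + s *\<^sub>R y"]
        by (simp add: scaleR_add_right)
      then show "q (t *\<^sub>R x) / t \<le> p (x + s *\<^sub>R y) - s * p y"
        using \<open>0 < t\<close> by (simp add: field_simps)
    qed
    then show "q (t *\<^sub>R x) \<le> t * q x"
      using \<open>0 < t\<close> by (simp add: field_simps)
  qed
qed

lemma minimal_sublinear_is_linear:
  assumes p: "sublinear p" and min: "\<And>q. sublinear q \<Longrightarrow> (\<And>x. q x \<le> p x) \<Longrightarrow> q = p"
  shows "linear p"
proof
  show add: "p (x + y) = p x + p y" for x y
  proof -
    obtain q where "sublinear q" "\<And>x. q x \<le> p x" "\<And>x. q x \<le> p (x + y) - p y"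
      using sublinear_tilt[OF p] by blast
    then have "p x \<le> p (x + y) - p y"
      using min by blast
    with sublinear_add[OF p, of x y] show ?thesis
      by simp
  qed
  \<comment> \<open>Oddness carries homogeneity over to negative scalars.\<close>
  have minus: "p (- x) = - p x" for x
    using add[of x "- x"] sublinear_0[OF p] by simp
  show "p (t *\<^sub>R x) = t *\<^sub>R p x" for t x
    using sublinear_scaleR[OF p, of t x] sublinear_scaleR[OF p, of "- t" x] minus[of "t *\<^sub>R x"]
      sublinear_0[OF p]
    by (cases t "0::real" rule: linorder_cases) auto
qed

text \<open>Zorn's lemma for the reversed pointwise order, so that maximal elements are minimal
  functionals; a nonempty chain is bounded by its pointwise infimum.\<close>

lemma minimal_sublinear_exists:
  assumes p: "sublinear p"
  obtains q where "sublinear q" "\<And>x. q x \<le> p x"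
    "\<And>r. sublinear r \<Longrightarrow> (\<And>x. r x \<le> q x) \<Longrightarrow> r = q"
proof -
  define A where "A = {q. sublinear q \<and> (\<forall>x. q x \<le> p x)}"
  define R where "R = (\<lambda>q r :: 'a \<Rightarrow> real. \<forall>x. r x \<le> q x)"
  have "\<exists>m\<in>A. \<forall>q\<in>A. R m q \<longrightarrow> q = m"
  proof (rule predicate_Zorn)
    show "partial_order_on A (relation_of R A)"
      by (rule partial_order_on_relation_ofI) (auto simp: R_def fun_eq_iff intro: order_trans antisym)
    fix C assume C: "C \<in> Chains (relation_of R A)"
    show "\<exists>u\<in>A. \<forall>q\<in>C. R q u"
    proof (cases "C = {}")
      case True
      then show ?thesis
        using p by (auto simp: A_def)
    next
      case False
      have CA: "sublinear q" "q x \<le> p x" if "q \<in> C" for q x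
        using C that unfolding Chains_def relation_of_def A_def by auto
      have chain: "R q r \<or> R r q" if "q \<in> C" "r \<in> C" for q r
        using C that unfolding Chains_def relation_of_def by auto
      define u where "u x = (INF q\<in>C. q x)" for x
      have "- p (- x) \<le> q x" if "q \<in> C" for q x
        using CA(1)[OF that] CA(2)[OF that, of "- x"] sublinear_minus[of q x] by simp
      then have bdd: "bdd_below ((\<lambda>q. q x) ` C)" for x
        by (rule bdd_belowI2)
      have lower: "u x \<le> q x" if "q \<in> C" for q x
        unfolding u_def by (rule cINF_lower[OF bdd that])
      have "sublinear u"
        unfolding sublinear_def
      proof safe
        fix x y
        \<comment> \<open>The smaller of \<open>q\<close> and \<open>r\<close> serves for both
          arguments: if it is \<open>q\<close>, then \<open>u (x + y)\<close> is at most
          \<open>q x + q y\<close>, hence at most \<open>q x + r y\<close>.\<close>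
        have "u (x + y) - r y \<le> u x" if "r \<in> C" for r
          unfolding u_def[of x]
        proof (rule cINF_greatest[OF False])
          fix q assume "q \<in> C"
          then show "u (x + y) - r y \<le> q x"
            using chain[OF \<open>q \<in> C\<close> that] lower[OF that, of "x + y"] lower[OF \<open>q \<in> C\<close>, of "x + y"]
              sublinear_add[OF CA(1)[OF that], of x y] sublinear_add[OF CA(1)[OF \<open>q \<in> C\<close>], of x y]
            unfolding R_def by (smt (verit))
        qed
        then have "u (x + y) - u x \<le> u y"
          unfolding u_def[of y] by (intro cINF_greatest[OF False]) (auto simp: algebra_simps)
        then show "u (x + y) \<le> u x + u y"
          by simp
      next
        fix t :: real and x assume t: "0 < t"
        have "u (t *\<^sub>R x) / t \<le> u x"
          unfolding u_def[of x]
        proof (rule cINF_greatest[OF False])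
          fix q assume q: "q \<in> C"
          show "u (t *\<^sub>R x) / t \<le> q x"
            using lower[OF q, of "t *\<^sub>R x"] t by (simp add: sublinear_scaleR[OF CA(1)[OF q] t] field_simps)
        qed
        then show "u (t *\<^sub>R x) \<le> t * u x"
          using t by (simp add: field_simps)
      qed
      moreover have "u x \<le> p x" for x
        using False CA(2) lower by (meson ex_in_conv order_trans)
      ultimately show ?thesis
        using lower by (auto simp: A_def R_def)
    qed
  qed
  then obtain m where m: "m \<in> A" "\<And>q. q \<in> A \<Longrightarrow> R m q \<Longrightarrow> q = m"
    by blast
  show thesis
  proof
    show "sublinear m" "\<And>x. m x \<le> p x"
      using m(1) by (auto simp: A_def)
    then show "r = m" if "sublinear r" "\<And>x. r x \<le> m x" for r
      using that m(2)[of r] by (force simp: A_def R_def intro: order_trans)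
  qed
qed

text \<open>Hahn-Banach without extension from a subspace: tilt the norm towards \<open>z\<close>
  and pass to a minimal sublinear functional below, which is linear. The tilted bound at
  \<open>- z\<close> forces \<open>f z\<close> up to \<open>norm z\<close>.\<close>

theorem norming_functional:
  fixes z :: "'a::real_normed_vector"
  obtains f :: "'a \<Rightarrow> real" where "bounded_linear f" "f z = norm z"
proof -
  obtain q :: "'a \<Rightarrow> real" where q: "sublinear q" "\<And>x. q x \<le> norm x" "\<And>x. q x \<le> norm (x + z) - norm z"
    using sublinear_tilt[OF sublinear_norm] by blast
  obtain f where f: "sublinear f" "\<And>x. f x \<le> q x" "\<And>r. sublinear r \<Longrightarrow> (\<And>x. r x \<le> f x) \<Longrightarrow> r = f"
    using minimal_sublinear_exists[OF q(1)] by blast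
  interpret f: linear f
    using minimal_sublinear_is_linear f(1,3) by blast
  have le: "f x \<le> norm x" for x
    using f(2) q(2) order_trans by blast
  show thesis
  proof
    have "\<bar>f x\<bar> \<le> norm x" for x
      using le[of x] le[of "- x"] by (simp add: f.neg abs_le_iff)
    then show "bounded_linear f"
      by (intro bounded_linear_intro[of f 1]) (simp_all add: f.add f.scale)
    have "f (- z) \<le> norm (- z + z) - norm z"
      using f(2) q(3) order_trans by blast
    then show "f z = norm z"
      using le[of z] by (simp add: f.neg)
  qed
qed

subsection \<open>Hermitian functionals\<close>

interpretation complex_vector: vector_space "scaleC :: complex \<Rightarrow> 'a::cstar_algebra \<Rightarrow> 'a"
  by (rule vector_space_scaleC)

lemma star_zero: "star (0::'a::cstar_algebra) = 0"
  using star_add[of "0::'a" 0] by simp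

lemma star_minus: "star (- x) = - star (x::'a::cstar_algebra)"
  using star_add[of x "- x"] by (simp add: star_zero minus_unique)

lemma star_scaleR: "star (r *\<^sub>R x) = r *\<^sub>R star (x::'a::cstar_algebra)"
  by (simp add: scaleR_scaleC star_scaleC)

text \<open>The C*-identity and submultiplicativity bound the square of \<open>norm x\<close> by
  \<open>norm (star x) * norm x\<close>; cancel, then repeat for \<open>star x\<close>.\<close>

lemma norm_star: "norm (star x) = norm (x::'a::cstar_algebra)"
proof -
  have le: "norm x \<le> norm (star x)" for x :: 'a
  proof -
    have "norm x * norm x \<le> norm (star x) * norm x"
      using cstar_identity[of x] norm_mult_ineq[of "star x" x] by (simp add: power2_eq_square)
    then show ?thesis
      by (cases "x = 0") auto
  qed
  show ?thesis
    using le[of x] le[of "star x"] by (simp add: star_star)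
qed

lemma star_mult_self_eq_0: "star x * x = 0 \<Longrightarrow> x = (0::'a::cstar_algebra)"
  using cstar_identity[of x] by simp

text \<open>Taking \<open>y = star x\<close> makes \<open>star x * x\<close> vanish after one use of
  the C*-identity, and \<open>x\<close> after a second.\<close>

lemma cstar_algebra_semiprime:
  fixes x :: "'a::cstar_algebra"
  assumes "\<And>y. x * y * x = 0"
  shows "x = 0"
proof -
  have "star (star x * x) * (star x * x) = star x * (x * star x * x)"
    by (simp add: star_mult star_star mult.assoc)
  then show ?thesis
    using assms star_mult_self_eq_0 by (metis mult_zero_right)
qed

section \<open>Self-adjoint real and imaginary parts\<close>

definition re :: "'a::cstar_algebra \<Rightarrow> 'a" where
  "re x = (1 / 2) *\<^sub>R (x + star x)"

text \<open>The usual \<open>(x - star x) / (2 i)\<close>, written through \<open>re\<close> so that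
  the properties of \<open>re\<close> carry over.\<close>

definition im :: "'a::cstar_algebra \<Rightarrow> 'a" where
  "im x = re (- \<i> *\<^sub>C x)"

lemma star_re [simp]: "star (re x) = re x"
  by (simp add: re_def star_scaleR star_add star_star add.commute)

lemma star_im [simp]: "star (im x) = im x"
  by (simp add: im_def)

lemma re_add: "re (x + y) = re x + re y"
  by (simp add: re_def star_add algebra_simps)

lemma im_add: "im (x + y) = im x + im y"
  unfolding im_def scaleC_add_right by (rule re_add)

lemma re_ii: "re (\<i> *\<^sub>C x) = - im x"
  by (simp add: im_def re_def star_minus scaleR_diff_right star_scaleC)

lemma im_ii: "im (\<i> *\<^sub>C x) = re x"
  by (simp add: im_def scaleC_scaleC)

lemma re_scaleR: "re (r *\<^sub>R x) = r *\<^sub>R re x"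
  by (simp add: re_def star_scaleR scaleR_add_right)

lemma im_scaleR: "im (r *\<^sub>R x) = r *\<^sub>R im x"
proof -
  have "- \<i> *\<^sub>C r *\<^sub>R x = r *\<^sub>R (- \<i> *\<^sub>C x)"
    unfolding scaleR_scaleC scaleC_scaleC by (simp only: mult.commute)
  then show ?thesis
    unfolding im_def by (simp only: re_scaleR)
qed

lemma re_im: "x = re x + \<i> *\<^sub>C im x"
proof -
  have "\<i> *\<^sub>C im x = (1 / 2) *\<^sub>R (x - star x)"
    by (simp add: im_def re_def star_scaleC star_minus scaleR_scaleC scaleC_scaleC
        complex_vector.scale_right_diff_distrib complex_vector.scale_right_distrib mult_ac)
  then show ?thesis
    by (simp add: re_def scaleR_add_right[symmetric] flip: scaleR_2)
qed

lemma norm_re_le: "norm (re x) \<le> norm x"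
  using norm_triangle_ineq[of x "star x"] by (simp add: re_def norm_star)

lemma norm_im_le: "norm (im x) \<le> norm x"
  using norm_re_le[of "- \<i> *\<^sub>C x"] by (simp add: im_def norm_scaleC)

definition hermitian_functional :: "('a::cstar_algebra \<Rightarrow> complex) \<Rightarrow> bool" where
  "hermitian_functional \<phi> \<longleftrightarrow> \<phi> \<in> dual_space \<and> (\<forall>x. \<phi> (star x) = cnj (\<phi> x))"

lemma dual_spaceI:
  fixes \<phi> :: "'a::cstar_algebra \<Rightarrow> complex"
  assumes add: "\<And>x y. \<phi> (x + y) = \<phi> x + \<phi> y" and scale: "\<And>c x. \<phi> (c *\<^sub>C x) = c * \<phi> x"
    and bound: "\<And>x. cmod (\<phi> x) \<le> norm x * K"
  shows "\<phi> \<in> dual_space"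
proof -
  have "vector_space ((*) :: complex \<Rightarrow> complex \<Rightarrow> complex)"
    by unfold_locales (simp_all add: algebra_simps)
  then have "Vector_Spaces.linear scaleC (*) \<phi>"
    using vector_space_scaleC by (simp add: Vector_Spaces.linear_iff add scale)
  moreover have "bounded_linear \<phi>"
    by (rule bounded_linear_intro[OF add _ bound]) (simp add: scaleR_scaleC scale scaleR_conv_of_real)
  ultimately show ?thesis
    by (simp add: dual_space_def)
qed

lemma dual_space_add: "\<phi> \<in> dual_space \<Longrightarrow> \<phi> (x + y) = \<phi> x + \<phi> y"
  and dual_space_scaleC: "\<phi> \<in> dual_space \<Longrightarrow> \<phi> (c *\<^sub>C x) = c * \<phi> x"
  and dual_space_bounded_linear: "\<phi> \<in> dual_space \<Longrightarrow> bounded_linear \<phi>"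
  by (simp_all add: dual_space_def Vector_Spaces.linear_iff)

lemma hermitian_functional_real: "hermitian_functional \<phi> \<Longrightarrow> star a = a \<Longrightarrow> Im (\<phi> a) = 0"
  unfolding hermitian_functional_def by (metis complex_cnj_cancel_iff cnj.simps(2) neg_equal_zero)

text \<open>Each bounded real functional \<open>g\<close> yields a hermitian one with real part
  \<open>g (re u)\<close> and imaginary part \<open>g (im u)\<close>. Hence every \<open>g\<close>
  vanishes on \<open>re z\<close> and \<open>im z\<close>, and norming functionals make both
  zero.\<close>

lemma hermitian_functionals_separate:
  fixes x y :: "'a::cstar_algebra"
  assumes "\<And>\<phi>. hermitian_functional \<phi> \<Longrightarrow> \<phi> x = \<phi> y"
  shows "x = y"
proof -
  define z where "z = x - y"
  have "g (re z) = 0 \<and> g (im z) = 0" if "bounded_linear g" for g :: "'a \<Rightarrow> real"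
  proof -
    interpret g: bounded_linear g by fact
    define \<phi> where "\<phi> u = Complex (g (re u)) (g (im u))" for u
    have add: "\<phi> (u + v) = \<phi> u + \<phi> v" for u v
      by (simp add: \<phi>_def re_add im_add g.add complex_eq_iff)
    have ii: "\<phi> (\<i> *\<^sub>C u) = \<i> * \<phi> u" for u
      by (simp add: \<phi>_def re_ii im_ii g.neg complex_eq_iff)
    have real: "\<phi> (r *\<^sub>R u) = of_real r * \<phi> u" for r u
      by (simp add: \<phi>_def re_scaleR im_scaleR g.scaleR complex_eq_iff)
    have "\<phi> (c *\<^sub>C u) = c * \<phi> u" for c u
    proof -
      have "c *\<^sub>C u = Re c *\<^sub>R u + \<i> *\<^sub>C Im c *\<^sub>R u"
        by (simp add: scaleR_scaleC scaleC_scaleC complex_eq flip: scaleC_add_left)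
      then show ?thesis
        by (simp add: add ii real complex_eq_iff)
    qed
    moreover obtain K where K: "\<And>u. norm (g u) \<le> norm u * K" "0 \<le> K"
      using g.nonneg_bounded by blast
    have "cmod (\<phi> u) \<le> norm u * (2 * K)" for u
      using cmod_le[of "\<phi> u"] K(1)[of "re u"] K(1)[of "im u"]
        mult_right_mono[OF norm_re_le[of u] K(2)] mult_right_mono[OF norm_im_le[of u] K(2)]
      by (simp add: \<phi>_def)
    ultimately have "\<phi> \<in> dual_space"
      by (intro dual_spaceI add)
    moreover have "\<phi> (star u) = cnj (\<phi> u)" for u
    proof -
      have "re (star u) = re u" "im (star u) = - im u"
        by (simp_all add: im_def re_def star_star star_scaleC star_minus scaleR_diff_right add.commute)
      then show ?thesis
        by (simp add: \<phi>_def g.neg complex_eq_iff)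
    qed
    ultimately have "\<phi> x = \<phi> y"
      using assms by (simp add: hermitian_functional_def)
    then have "\<phi> z = 0"
      using add[of z y] by (simp add: z_def)
    then show ?thesis
      by (simp add: \<phi>_def complex_eq_iff)
  qed
  then have "re z = 0" "im z = 0"
    using norming_functional by (metis norm_eq_zero)+
  then show ?thesis
    using re_im[of z] by (simp add: z_def)
qed

subsection \<open>Weak-2-local *-derivations\<close>

lemma star_derivationD:
  assumes "star_derivation D"
  shows "D (x + y) = D x + D y" "D (c *\<^sub>C x) = c *\<^sub>C D x" "D (x * y) = D x * y + x * D y"
    "D (star x) = star (D x)"
  using assms by (simp_all add: star_derivation_def derivation_def Vector_Spaces.linear_iff)

context
  fixes \<Delta> :: "'a::cstar_algebra \<Rightarrow> 'a"
  assumes \<Delta>: "weak_2_local_star_derivation \<Delta>"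
begin

lemma two_local:
  assumes "\<phi> \<in> dual_space"
  obtains D where "star_derivation D" "\<phi> (\<Delta> a) = \<phi> (D a)" "\<phi> (\<Delta> b) = \<phi> (D b)"
  using \<Delta> assms unfolding weak_2_local_star_derivation_def by blast

lemma \<Delta>_scaleC: "\<Delta> (c *\<^sub>C x) = c *\<^sub>C \<Delta> x"
proof (rule hermitian_functionals_separate)
  fix \<phi> :: "'a \<Rightarrow> complex" assume "hermitian_functional \<phi>"
  then have \<phi>: "\<phi> \<in> dual_space"
    by (simp add: hermitian_functional_def)
  obtain D where "star_derivation D" "\<phi> (\<Delta> x) = \<phi> (D x)" "\<phi> (\<Delta> (c *\<^sub>C x)) = \<phi> (D (c *\<^sub>C x))"
    using two_local[OF \<phi>] by blast
  then show "\<phi> (\<Delta> (c *\<^sub>C x)) = \<phi> (c *\<^sub>C \<Delta> x)"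
    by (simp add: star_derivationD dual_space_scaleC[OF \<phi>])
qed

lemma \<Delta>_star: "\<Delta> (star x) = star (\<Delta> x)"
proof (rule hermitian_functionals_separate)
  fix \<phi> :: "'a \<Rightarrow> complex" assume h: "hermitian_functional \<phi>"
  then have \<phi>: "\<phi> \<in> dual_space"
    by (simp add: hermitian_functional_def)
  obtain D where "star_derivation D" "\<phi> (\<Delta> x) = \<phi> (D x)" "\<phi> (\<Delta> (star x)) = \<phi> (D (star x))"
    using two_local[OF \<phi>] by blast
  then show "\<phi> (\<Delta> (star x)) = \<phi> (star (\<Delta> x))"
    using h by (simp add: star_derivationD hermitian_functional_def)
qed

text \<open>For hermitian \<open>\<phi>\<close>, the value of \<open>\<phi>\<close> at
  \<open>D (a + \<i> *\<^sub>C b)\<close> has real part \<open>\<phi> (D a)\<close> and imaginary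
  part \<open>\<phi> (D b)\<close>. Pairing the point with \<open>a\<close> settles the real part
  and pairing it with \<open>b\<close> the imaginary part; the two derivations may differ.\<close>

lemma \<Delta>_split:
  assumes a: "star a = a" and b: "star b = b"
  shows "\<Delta> (a + \<i> *\<^sub>C b) = \<Delta> a + \<i> *\<^sub>C \<Delta> b"
proof (rule hermitian_functionals_separate)
  fix \<phi> :: "'a \<Rightarrow> complex" assume h: "hermitian_functional \<phi>"
  then have \<phi>: "\<phi> \<in> dual_space"
    by (simp add: hermitian_functional_def)
  have real: "Im (\<phi> (D c)) = 0" if "star_derivation D" "star c = c" for D c
    using hermitian_functional_real[OF h, of "D c"] star_derivationD(4)[OF that(1), of c] that(2) by simp
  obtain D where D: "star_derivation D" "\<phi> (\<Delta> a) = \<phi> (D a)"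
      "\<phi> (\<Delta> (a + \<i> *\<^sub>C b)) = \<phi> (D (a + \<i> *\<^sub>C b))"
    using two_local[OF \<phi>] by blast
  obtain E where E: "star_derivation E" "\<phi> (\<Delta> b) = \<phi> (E b)"
      "\<phi> (\<Delta> (a + \<i> *\<^sub>C b)) = \<phi> (E (a + \<i> *\<^sub>C b))"
    using two_local[OF \<phi>] by blast
  have "Re (\<phi> (\<Delta> (a + \<i> *\<^sub>C b))) = Re (\<phi> (D a))"
    unfolding D(3)
    by (simp add: star_derivationD[OF D(1)] dual_space_add[OF \<phi>] dual_space_scaleC[OF \<phi>] real[OF D(1) b])
  moreover have "Im (\<phi> (\<Delta> (a + \<i> *\<^sub>C b))) = Re (\<phi> (E b))"
    unfolding E(3)
    by (simp add: star_derivationD[OF E(1)] dual_space_add[OF \<phi>] dual_space_scaleC[OF \<phi>] real[OF E(1) a])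
  ultimately show "\<phi> (\<Delta> (a + \<i> *\<^sub>C b)) = \<phi> (\<Delta> a + \<i> *\<^sub>C \<Delta> b)"
    using real[OF D(1) a] real[OF E(1) b]
    by (simp add: complex_eq_iff D(2) E(2) dual_space_add[OF \<phi>] dual_space_scaleC[OF \<phi>])
qed

text \<open>A single test functional at \<open>a + \<i>b\<close> and \<open>a + b\<close> compares \<open>\<Delta>\<close> at the three points
  \<open>a\<close>, \<open>b\<close> and \<open>a + b\<close>.\<close>

lemma \<Delta>_add_selfadjoint:
  assumes a: "star a = a" and b: "star b = b"
  shows "\<Delta> (a + b) = \<Delta> a + \<Delta> b"
proof (rule hermitian_functionals_separate)
  fix \<phi> :: "'a \<Rightarrow> complex" assume h: "hermitian_functional \<phi>"
  then have \<phi>: "\<phi> \<in> dual_space"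
    by (simp add: hermitian_functional_def)
  obtain D where D: "star_derivation D" "\<phi> (\<Delta> (a + b)) = \<phi> (D (a + b))"
      "\<phi> (\<Delta> (a + \<i> *\<^sub>C b)) = \<phi> (D (a + \<i> *\<^sub>C b))"
    using two_local[OF \<phi>] by blast
  have real: "Im (\<phi> (D c)) = 0" "Im (\<phi> (\<Delta> c)) = 0" if "star c = c" for c
    using hermitian_functional_real[OF h] star_derivationD(4)[OF D(1), of c] \<Delta>_star[of c] that by simp_all
  \<comment> \<open>Real and imaginary parts of the equation at \<open>a + \<i> *\<^sub>C b\<close>
    show that \<open>\<Delta>\<close> and this one \<open>D\<close> agree under
    \<open>\<phi>\<close> at both \<open>a\<close> and \<open>b\<close>.\<close>
  show "\<phi> (\<Delta> (a + b)) = \<phi> (\<Delta> a + \<Delta> b)"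
    using D(2,3) real[OF a] real[OF b]
    by (simp add: \<Delta>_split[OF a b] star_derivationD[OF D(1)] dual_space_add[OF \<phi>]
        dual_space_scaleC[OF \<phi>] complex_eq_iff)
qed

lemma \<Delta>_add: "\<Delta> (x + y) = \<Delta> x + \<Delta> y"
proof -
  have "\<Delta> (x + y) = \<Delta> ((re x + re y) + \<i> *\<^sub>C (im x + im y))"
    using re_im[of "x + y"] by (simp add: re_add im_add)
  also have "\<dots> = (\<Delta> (re x) + \<i> *\<^sub>C \<Delta> (im x)) + (\<Delta> (re y) + \<i> *\<^sub>C \<Delta> (im y))"
    by (subst \<Delta>_split) (simp_all add: \<Delta>_add_selfadjoint star_add scaleC_add_right)
  also have "\<dots> = \<Delta> x + \<Delta> y"
    using re_im[of x] re_im[of y] by (simp flip: \<Delta>_split)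
  finally show ?thesis .
qed

text \<open>The imaginary part of \<open>\<phi> - \<i>\<theta>\<close> at \<open>D (a + \<i>a\<^sup>2)\<close> is \<open>\<phi> (D (a\<^sup>2)) - \<theta> (D a)\<close>,
  which vanishes for derivations when \<open>\<theta> = \<phi> (_ a + a _)\<close>.\<close>

lemma \<Delta>_square_selfadjoint:
  assumes a: "star a = a"
  shows "\<Delta> (a * a) = \<Delta> a * a + a * \<Delta> a"
proof (rule hermitian_functionals_separate)
  fix \<phi> :: "'a \<Rightarrow> complex" assume h: "hermitian_functional \<phi>"
  then have \<phi>: "\<phi> \<in> dual_space"
    by (simp add: hermitian_functional_def)
  define \<theta> where "\<theta> u = \<phi> (u * a + a * u)" for u
  define \<psi> where "\<psi> u = \<phi> u - \<i> * \<theta> u" for u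
  have \<theta>_real: "Im (\<theta> u) = 0" if "star u = u" for u
    unfolding \<theta>_def by (rule hermitian_functional_real[OF h]) (simp add: star_add star_mult a that add.commute)
  have \<phi>_real: "Im (\<phi> u) = 0" if "star u = u" for u
    by (rule hermitian_functional_real[OF h that])
  obtain K where K: "\<And>u. cmod (\<phi> u) \<le> norm u * K" "0 \<le> K"
    using bounded_linear.nonneg_bounded[OF dual_space_bounded_linear[OF \<phi>]] by blast
  \<comment> \<open>\<open>\<psi>\<close> need not be hermitian, but it is a legitimate test
    functional: multiplication by \<open>a\<close> on either side is bounded by
    \<open>norm a\<close>, which gives the constant below.\<close>
  have \<psi>: "\<psi> \<in> dual_space"
  proof (rule dual_spaceI)
    fix u
    have "norm (u * a + a * u) \<le> norm u * (2 * norm a)"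
      using norm_triangle_ineq[of "u * a" "a * u"] norm_mult_ineq[of u a] norm_mult_ineq[of a u]
      by (simp add: algebra_simps)
    then have "norm (u * a + a * u) * K \<le> norm u * (2 * norm a) * K"
      by (rule mult_right_mono) (rule K(2))
    moreover have "cmod (\<psi> u) \<le> cmod (\<phi> u) + cmod (\<theta> u)"
      using norm_triangle_ineq4[of "\<phi> u" "\<i> * \<theta> u"] by (simp add: \<psi>_def norm_mult)
    ultimately show "cmod (\<psi> u) \<le> norm u * (K + 2 * norm a * K)"
      using K(1)[of u] K(1)[of "u * a + a * u"] by (simp add: \<theta>_def algebra_simps)
  qed (simp_all add: \<psi>_def \<theta>_def dual_space_add[OF \<phi>] dual_space_scaleC[OF \<phi>]
      mult_scaleC_left mult_scaleC_right algebra_simps)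
  \<comment> \<open>Of the four terms of \<open>\<psi> (u + \<i> *\<^sub>C v)\<close>, those in
    \<open>\<phi> u\<close> and \<open>\<theta> v\<close> are real.\<close>
  have split: "Im (\<psi> (u + \<i> *\<^sub>C v)) = Re (\<phi> v) - Re (\<theta> u)" if "star u = u" "star v = v" for u v
    using \<phi>_real[OF that(1)] \<theta>_real[OF that(2)]
    by (simp add: \<psi>_def dual_space_add[OF \<phi>] dual_space_scaleC[OF \<phi>] \<theta>_def
        mult_scaleC_left mult_scaleC_right algebra_simps)
  have aa: "star (a * a) = a * a"
    by (simp add: star_mult a)
  obtain D where D: "star_derivation D" "\<psi> (\<Delta> (a + \<i> *\<^sub>C (a * a))) = \<psi> (D (a + \<i> *\<^sub>C (a * a)))"
    using two_local[OF \<psi>] by blast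
  have "Im (\<psi> (D (a + \<i> *\<^sub>C (a * a)))) = Re (\<phi> (D (a * a))) - Re (\<theta> (D a))"
    unfolding star_derivationD(1,2)[OF D(1)]
    by (rule split) (simp_all only: a aa flip: star_derivationD(4)[OF D(1)])
  moreover have "\<phi> (D (a * a)) = \<theta> (D a)"
    by (simp add: \<theta>_def star_derivationD[OF D(1)])
  moreover have "Im (\<psi> (\<Delta> (a + \<i> *\<^sub>C (a * a)))) = Re (\<phi> (\<Delta> (a * a))) - Re (\<theta> (\<Delta> a))"
    unfolding \<Delta>_split[OF a aa] by (rule split) (simp_all only: a aa flip: \<Delta>_star)
  ultimately have "Re (\<phi> (\<Delta> (a * a))) = Re (\<theta> (\<Delta> a))"
    using D(2) by simp
  moreover have "Im (\<phi> (\<Delta> (a * a))) = 0" "Im (\<theta> (\<Delta> a)) = 0"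
    by (rule \<phi>_real \<theta>_real; simp only: a aa flip: \<Delta>_star)+
  ultimately show "\<phi> (\<Delta> (a * a)) = \<phi> (\<Delta> a * a + a * \<Delta> a)"
    by (simp add: complex_eq_iff \<theta>_def)
qed

text \<open>Polarising the self-adjoint case gives the rule for \<open>a * b + b * a\<close>, the
  remaining ingredient of the square of \<open>a + \<i> *\<^sub>C b\<close>.\<close>

lemma \<Delta>_square: "\<Delta> (x * x) = \<Delta> x * x + x * \<Delta> x"
proof -
  define a b where "a = re x" and "b = im x"
  have sa: "star a = a" "star b = b" "star (a + b) = a + b"
    by (simp_all add: a_def b_def star_add)
  have ab: "\<Delta> (a * b) + \<Delta> (b * a) = \<Delta> a * b + a * \<Delta> b + \<Delta> b * a + b * \<Delta> a"
    using \<Delta>_square_selfadjoint[OF sa(3)] \<Delta>_square_selfadjoint[OF sa(1)] \<Delta>_square_selfadjoint[OF sa(2)]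
    by (simp add: \<Delta>_add algebra_simps)
  have x: "x = a + \<i> *\<^sub>C b"
    unfolding a_def b_def by (rule re_im)
  have "x * x = a * a + (- 1) *\<^sub>C (b * b) + \<i> *\<^sub>C (a * b + b * a)"
    unfolding x by (simp add: mult_scaleC_left mult_scaleC_right scaleC_scaleC scaleC_add_right algebra_simps)
  then have "\<Delta> (x * x) = \<Delta> (a * a) + (- 1) *\<^sub>C \<Delta> (b * b) + \<i> *\<^sub>C (\<Delta> (a * b) + \<Delta> (b * a))"
    by (simp only: \<Delta>_add \<Delta>_scaleC)
  also have "\<dots> = \<Delta> x * x + x * \<Delta> x"
    unfolding ab \<Delta>_square_selfadjoint[OF sa(1)] \<Delta>_square_selfadjoint[OF sa(2)] x
    by (simp add: \<Delta>_add \<Delta>_scaleC mult_scaleC_left mult_scaleC_right scaleC_scaleC scaleC_add_right algebra_simps)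
  finally show ?thesis .
qed

lemma \<Delta>_mult: "\<Delta> (x * y) = \<Delta> x * y + x * \<Delta> y"
proof -
  interpret semiprime_jordan \<Delta>
  proof
    show "u = 0" if "u + u = 0" for u :: 'a
      using that by (simp flip: scaleR_2)
  qed (fact cstar_algebra_semiprime \<Delta>_add \<Delta>_square)+
  show ?thesis
    by (rule jordan_derivation_is_derivation)
qed

end

theorem corollary2p10:
  fixes \<Delta> :: "'a::cstar_algebra \<Rightarrow> 'a"
  assumes "weak_2_local_star_derivation \<Delta>"
  shows "star_derivation \<Delta>"
  unfolding star_derivation_def derivation_def Vector_Spaces.linear_iff
  using assms vector_space_scaleC \<Delta>_add \<Delta>_scaleC \<Delta>_mult \<Delta>_star by blast

end
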